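(* Let $\aleph$ be a Riemannian manifold with maps $E,\eta$ as in the context, let $S\subset\aleph$ be a geodesic local E-invex (GLEI) set with respect to $\eta$, and let $f:S\to\mathbb{R}$ be a geodesic local E-preinvex (GLEP) function on $S$ with respect to $\eta$. Then $f$ is a geodesic semilocal E-preinvex (GSLEP) function on $S$ with respect to $\eta$ if and only if $f(E(\kappa))\le f(\kappa)$ for all $\kappa\in S$.
   Context: Setting: $\aleph$ is a Riemannian manifold, $E:\aleph\to\aleph$ is a map, and $\eta:\aleph\times\aleph\to T\aleph$ is a map with $\eta(x,y)\in T_y\aleph$. For points $\kappa_1,\kappa_2$, $\gamma_{E(\kappa_1),E(\kappa_2)}:[0,1]\to\aleph$ denotes the (unique) geodesic with $\gamma_{E(\kappa_1),E(\kappa_2)}(0)=E(\kappa_2)$ and initial velocity $\gamma'_{E(\kappa_1),E(\kappa_2)}(0)=\eta(E(\kappa_1),E(\kappa_2))$. GLEI set: a nonempty set $S\subset\aleph$ is geodesic local E-invex with respect to $\eta$ if for all $\kappa_1,\kappa_2\in S$ the geodesic $\gamma_{E(\kappa_1),E(\kappa_2)}:[0,1]\to\aleph$ exists and there is $u(\kappa_1,\kappa_2)\in(0,1]$ such that $\gamma_{E(\kappa_1),E(\kappa_2)}(t)\in S$ for all $t\in[0,u(\kappa_1,\kappa_2)]$. (In particular $E(\kappa)\in S$ for $\kappa\in S$, taking $t=0$.) GLEP function: $f$ is geodesic local E-preinvex on the GLEI set $S$ if for any $\kappa_1,\kappa_2\in S$ there is $v(\kappa_1,\kappa_2)$ with $0<v(\kappa_1,\kappa_2)\le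 u(\kappa_1,\kappa_2)$ such that $f(\gamma_{E(\kappa_1),E(\kappa_2)}(t))\le t f(E(\kappa_1))+(1-t)f(E(\kappa_2))$ for all $t\in[0,v(\kappa_1,\kappa_2)]$. GSLEP function: $f$ is geodesic semilocal E-preinvex on the GLEI set $S$ if for any $\kappa_1,\kappa_2\in S$ there is $v(\kappa_1,\kappa_2)$ with $0<v(\kappa_1,\kappa_2)\le u(\kappa_1,\kappa_2)\le 1$ such that $f(\gamma_{E(\kappa_1),E(\kappa_2)}(t))\le t f(\kappa_1)+(1-t)f(\kappa_2)$ for all $t\in[0,v(\kappa_1,\kappa_2)]$. *)

theory Defs
  imports "HOL-Analysis.Analysis"
begin

text \<open>
  The distribution has no smooth manifolds, so manifolds, tangent vectors, Riemannian metrics and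
  geodesics are set up here through charts.
\<close>

primrec Ck_on :: "nat \<Rightarrow> ('e::euclidean_space \<Rightarrow> 'b::real_normed_vector) \<Rightarrow> 'e set \<Rightarrow> bool" where
  "Ck_on 0 f U \<longleftrightarrow> continuous_on U f"
| "Ck_on (Suc k) f U \<longleftrightarrow>
     (\<forall>x\<in>U. f differentiable (at x)) \<and>
     (\<forall>v. Ck_on k (\<lambda>x. frechet_derivative f (at x) v) U)"

definition smooth_on :: "('e::euclidean_space \<Rightarrow> 'b::real_normed_vector) \<Rightarrow> 'e set \<Rightarrow> bool" where
  "smooth_on f U \<longleftrightarrow> open U \<and> (\<forall>k. Ck_on k f U)"


section \<open>Smooth manifolds\<close>

text \<open>A chart is its domain together with the coordinate map, whose values outside the domain are
  irrelevant.\<close>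

type_synonym ('m, 'e) chart = "'m set \<times> ('m \<Rightarrow> 'e)"

text \<open>A tangent vector is given by its components in all charts around its base point
  (and is 0 on all other charts).\<close>

type_synonym ('m, 'e) tangent_vector = "('m, 'e) chart \<Rightarrow> 'e"

record ('m, 'e) manifold =
  points :: "'m topology"
  atlas :: "('m, 'e) chart set"

definition chart_inv :: "('m, 'e) chart \<Rightarrow> 'e \<Rightarrow> 'm" where
  "chart_inv c = inv_into (fst c) (snd c)"

definition transition :: "('m, 'e) chart \<Rightarrow> ('m, 'e) chart \<Rightarrow> 'e \<Rightarrow> 'e" where
  "transition c d = snd d \<circ> chart_inv c"

definition smooth_manifold :: "('m, 'e::euclidean_space, 'z) manifold_scheme \<Rightarrow> bool" where
  "smooth_manifold M \<longleftrightarrow>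
     Hausdorff_space (points M) \<and>
     second_countable (points M) \<and>
     \<Union> (fst ` atlas M) = topspace (points M) \<and>
     (\<forall>c\<in>atlas M. openin (points M) (fst c) \<and> open (snd c ` fst c) \<and>
        homeomorphic_map (subtopology (points M) (fst c)) (top_of_set (snd c ` fst c)) (snd c)) \<and>
     (\<forall>c\<in>atlas M. \<forall>d\<in>atlas M. smooth_on (transition c d) (snd c ` (fst c \<inter> fst d)))"

definition charts_at :: "('m, 'e, 'z) manifold_scheme \<Rightarrow> 'm \<Rightarrow> ('m, 'e) chart set" where
  "charts_at M p = {c \<in> atlas M. p \<in> fst c}"

definition change_comp :: "('m, 'e::euclidean_space) chart \<Rightarrow> ('m, 'e) chart \<Rightarrow> 'm \<Rightarrow> 'e \<Rightarrow> 'e" where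
  "change_comp c d p = frechet_derivative (transition c d) (at (snd c p))"

definition tangent_space ::
    "('m, 'e::euclidean_space, 'z) manifold_scheme \<Rightarrow> 'm \<Rightarrow> ('m, 'e) tangent_vector set" where
  "tangent_space M p =
     {w. (\<forall>c\<in>charts_at M p. \<forall>d\<in>charts_at M p. w d = change_comp c d p (w c)) \<and>
         (\<forall>c. c \<notin> charts_at M p \<longrightarrow> w c = 0)}"

text \<open>The tangent vector at \<open>p\<close> whose components in the chart \<open>c\<close> are \<open>u\<close>. For a chart around \<open>p\<close>
  this map from \<open>u\<close> to the tangent space is the isomorphism that defines its linear structure.\<close>

definition coord_vector ::
    "('m, 'e::euclidean_space, 'z) manifold_scheme \<Rightarrow> ('m, 'e) chart \<Rightarrow> 'm \<Rightarrow> 'e \<Rightarrow> ('m, 'e) tangent_vector" where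
  "coord_vector M c p u = (\<lambda>d. if d \<in> charts_at M p then change_comp c d p u else 0)"

text \<open>Curves are parametrised by the unit interval; at its end points derivatives are one-sided.\<close>

definition velocity ::
    "('m, 'e::euclidean_space, 'z) manifold_scheme \<Rightarrow> (real \<Rightarrow> 'm) \<Rightarrow> real \<Rightarrow> ('m, 'e) tangent_vector" where
  "velocity M \<gamma> t = (\<lambda>c. if c \<in> charts_at M (\<gamma> t)
      then vector_derivative (snd c \<circ> \<gamma>) (at t within {0..1}) else 0)"


section \<open>Riemannian metrics and geodesics\<close>

record ('m, 'e) riemannian = "('m, 'e) manifold" +
  metric :: "'m \<Rightarrow> ('m, 'e) tangent_vector \<Rightarrow> ('m, 'e) tangent_vector \<Rightarrow> real"

text \<open>The metric in the coordinates of the chart \<open>c\<close>: on basis vectors these are the usual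
  \<open>g\<^sub>i\<^sub>j(x)\<close>.\<close>

definition coord_metric ::
    "('m, 'e::euclidean_space) riemannian \<Rightarrow> ('m, 'e) chart \<Rightarrow> 'e \<Rightarrow> 'e \<Rightarrow> 'e \<Rightarrow> real" where
  "coord_metric M c x u v =
     (let p = chart_inv c x in metric M p (coord_vector M c p u) (coord_vector M c p v))"

definition riemannian_manifold :: "('m, 'e::euclidean_space) riemannian \<Rightarrow> bool" where
  "riemannian_manifold M \<longleftrightarrow>
     smooth_manifold M \<and>
     (\<forall>c\<in>atlas M.
        (\<forall>x \<in> snd c ` fst c.
           bilinear (coord_metric M c x) \<and>
           (\<forall>u v. coord_metric M c x u v = coord_metric M c x v u) \<and>
           (\<forall>u. u \<noteq> 0 \<longrightarrow> coord_metric M c x u u > 0)) \<and>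
        (\<forall>u v. smooth_on (\<lambda>x. coord_metric M c x u v) (snd c ` fst c)))"

text \<open>Christoffel symbols of the Levi-Civita connection, contracted with \<open>u\<close> and \<open>v\<close>. On basis
  vectors the defining property reads
  \<open>g\<^sub>k\<^sub>l \<Gamma>\<^sup>k\<^sub>i\<^sub>j = (\<partial>\<^sub>i g\<^sub>j\<^sub>l + \<partial>\<^sub>j g\<^sub>i\<^sub>l - \<partial>\<^sub>l g\<^sub>i\<^sub>j) / 2\<close>.\<close>

definition christoffel ::
    "('m, 'e::euclidean_space) riemannian \<Rightarrow> ('m, 'e) chart \<Rightarrow> 'e \<Rightarrow> 'e \<Rightarrow> 'e \<Rightarrow> 'e" where
  "christoffel M c x u v =
     (let D = (\<lambda>a b w. frechet_derivative (\<lambda>y. coord_metric M c y a b) (at x) w)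
      in THE z. \<forall>w. coord_metric M c x z w = (D v w u + D u w v - D u v w) / 2)"

text \<open>In every chart, the coordinates \<open>x\<close> of the curve satisfy \<open>x'' = - \<Gamma>(x)(x', x')\<close>,
  written as a first order system for \<open>x\<close> and \<open>x' = v\<close>.\<close>

definition geodesic :: "('m, 'e::euclidean_space) riemannian \<Rightarrow> (real \<Rightarrow> 'm) \<Rightarrow> bool" where
  "geodesic M \<gamma> \<longleftrightarrow>
     continuous_map (top_of_set {0..1}) (points M) \<gamma> \<and>
     (\<forall>c\<in>atlas M. \<exists>v. \<forall>t\<in>{0..1}. \<gamma> t \<in> fst c \<longrightarrow>
        ((snd c \<circ> \<gamma>) has_vector_derivative v t) (at t within {0..1}) \<and>
        (v has_vector_derivative - christoffel M c (snd c (\<gamma> t)) (v t) (v t)) (at t within {0..1}))"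

definition geodesic_from ::
    "('m, 'e::euclidean_space) riemannian \<Rightarrow> 'm \<Rightarrow> ('m, 'e) tangent_vector \<Rightarrow> (real \<Rightarrow> 'm) \<Rightarrow> bool" where
  "geodesic_from M p w \<gamma> \<longleftrightarrow> geodesic M \<gamma> \<and> \<gamma> 0 = p \<and> velocity M \<gamma> 0 = w"

text \<open>The geodesic with \<open>\<gamma>(0) = y\<close> and \<open>\<gamma>'(0) = \<eta>(x, y)\<close>. On a Riemannian manifold the initial data
  determine it on the unit interval, and only these values are ever used; since functions are
  total, it is still not unique as a function on the reals, hence the choice operator. Nothing is
  known about it unless such a geodesic exists.\<close>

definition eta_geodesic ::
    "('m, 'e::euclidean_space) riemannian \<Rightarrow> ('m \<Rightarrow> 'm \<Rightarrow> ('m, 'e) tangent_vector) \<Rightarrow>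
     'm \<Rightarrow> 'm \<Rightarrow> real \<Rightarrow> 'm" where
  "eta_geodesic M \<eta> x y = (SOME \<gamma>. geodesic_from M y (\<eta> x y) \<gamma>)"


section \<open>Geodesic local E-invexity and E-preinvexity\<close>

text \<open>The function \<open>u\<close> is the one of the definition of a GLEI set; it is kept as a parameter because
  the GLEP and GSLEP properties refer to it. A set is GLEI iff \<open>GLEI_set\<close> holds for some \<open>u\<close>.\<close>

definition GLEI_set ::
    "('m, 'e::euclidean_space) riemannian \<Rightarrow> ('m \<Rightarrow> 'm) \<Rightarrow> ('m \<Rightarrow> 'm \<Rightarrow> ('m, 'e) tangent_vector) \<Rightarrow>
     ('m \<Rightarrow> 'm \<Rightarrow> real) \<Rightarrow> 'm set \<Rightarrow> bool" where
  "GLEI_set M E \<eta> u S \<longleftrightarrow>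
     S \<noteq> {} \<and> S \<subseteq> topspace (points M) \<and>
     (\<forall>x\<in>S. \<forall>y\<in>S.
        (\<exists>\<gamma>. geodesic_from M (E y) (\<eta> (E x) (E y)) \<gamma>) \<and>
        0 < u x y \<and> u x y \<le> 1 \<and>
        (\<forall>t\<in>{0..u x y}. eta_geodesic M \<eta> (E x) (E y) t \<in> S))"

definition GLEP_function ::
    "('m, 'e::euclidean_space) riemannian \<Rightarrow> ('m \<Rightarrow> 'm) \<Rightarrow> ('m \<Rightarrow> 'm \<Rightarrow> ('m, 'e) tangent_vector) \<Rightarrow>
     ('m \<Rightarrow> 'm \<Rightarrow> real) \<Rightarrow> 'm set \<Rightarrow> ('m \<Rightarrow> real) \<Rightarrow> bool" where
  "GLEP_function M E \<eta> u S f \<longleftrightarrow>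
     (\<forall>x\<in>S. \<forall>y\<in>S. \<exists>v. 0 < v \<and> v \<le> u x y \<and>
        (\<forall>t\<in>{0..v}. f (eta_geodesic M \<eta> (E x) (E y) t) \<le> t * f (E x) + (1 - t) * f (E y)))"

definition GSLEP_function ::
    "('m, 'e::euclidean_space) riemannian \<Rightarrow> ('m \<Rightarrow> 'm) \<Rightarrow> ('m \<Rightarrow> 'm \<Rightarrow> ('m, 'e) tangent_vector) \<Rightarrow>
     ('m \<Rightarrow> 'm \<Rightarrow> real) \<Rightarrow> 'm set \<Rightarrow> ('m \<Rightarrow> real) \<Rightarrow> bool" where
  "GSLEP_function M E \<eta> u S f \<longleftrightarrow>
     (\<forall>x\<in>S. \<forall>y\<in>S. \<exists>v. 0 < v \<and> v \<le> u x y \<and> u x y \<le> 1 \<and>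
        (\<forall>t\<in>{0..v}. f (eta_geodesic M \<eta> (E x) (E y) t) \<le> t * f x + (1 - t) * f y))"

end

theory Submission
  imports Defs
begin

lemma eta_geodesic_0:
  assumes "geodesic_from M y (\<eta> x y) \<gamma>"
  shows "eta_geodesic M \<eta> x y 0 = y"
proof -
  have "geodesic_from M y (\<eta> x y) (eta_geodesic M \<eta> x y)"
    unfolding eta_geodesic_def using assms by (rule someI[where P = "geodesic_from M y (\<eta> x y)"])
  then show ?thesis
    by (simp add: geodesic_from_def)
qed

theorem theorem2p15:
  fixes M :: "('m, 'e::euclidean_space) riemannian"
    and E :: "'m \<Rightarrow> 'm"
    and \<eta> :: "'m \<Rightarrow> 'm \<Rightarrow> ('m, 'e) tangent_vector"
    and u :: "'m \<Rightarrow> 'm \<Rightarrow> real"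
    and S :: "'m set"
    and f :: "'m \<Rightarrow> real"
  assumes "riemannian_manifold M"
    and "E \<in> topspace (points M) \<rightarrow> topspace (points M)"
    and "\<And>x y. x \<in> topspace (points M) \<Longrightarrow> y \<in> topspace (points M) \<Longrightarrow> \<eta> x y \<in> tangent_space M y"
    and "GLEI_set M E \<eta> u S"
    and "GLEP_function M E \<eta> u S f"
  shows "GSLEP_function M E \<eta> u S f \<longleftrightarrow> (\<forall>x\<in>S. f (E x) \<le> f x)"
proof
  assume semi: "GSLEP_function M E \<eta> u S f"
  show "\<forall>x\<in>S. f (E x) \<le> f x"
  proof
    fix x assume "x \<in> S"
    with semi obtain v where "0 < v"
      and v: "\<forall>t\<in>{0..v}. f (eta_geodesic M \<eta> (E x) (E x) t) \<le> t * f x + (1 - t) * f x"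
      unfolding GSLEP_function_def by blast
    from v \<open>0 < v\<close> have "f (eta_geodesic M \<eta> (E x) (E x) 0) \<le> f x"
      by (auto dest: bspec[where x = 0])
    moreover from assms(4) \<open>x \<in> S\<close> have "eta_geodesic M \<eta> (E x) (E x) 0 = E x"
      unfolding GLEI_set_def by (blast intro: eta_geodesic_0)
    ultimately show "f (E x) \<le> f x"
      by simp
  qed
next
  assume le: "\<forall>x\<in>S. f (E x) \<le> f x"
  show "GSLEP_function M E \<eta> u S f"
    unfolding GSLEP_function_def
  proof (intro ballI)
    fix x y assume xy: "x \<in> S" "y \<in> S"
    with assms(5) obtain v where v: "0 < v" "v \<le> u x y"
      and pre: "\<forall>t\<in>{0..v}. f (eta_geodesic M \<eta> (E x) (E y) t) \<le> t * f (E x) + (1 - t) * f (E y)"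
      unfolding GLEP_function_def by blast
    from assms(4) xy have u: "u x y \<le> 1"
      unfolding GLEI_set_def by blast
    have "f (eta_geodesic M \<eta> (E x) (E y) t) \<le> t * f x + (1 - t) * f y" if t: "t \<in> {0..v}" for t
    proof -
      have "f (eta_geodesic M \<eta> (E x) (E y) t) \<le> t * f (E x) + (1 - t) * f (E y)"
        using pre t by blast
      also have "\<dots> \<le> t * f x + (1 - t) * f y"
        using le xy t v u by (intro add_mono mult_left_mono) auto
      finally show ?thesis .
    qed
    with v u show "\<exists>v. 0 < v \<and> v \<le> u x y \<and> u x y \<le> 1 \<and>
        (\<forall>t\<in>{0..v}. f (eta_geodesic M \<eta> (E x) (E y) t) \<le> t * f x + (1 - t) * f y)"
      by blast
  qed
qed

end
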